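(* Let $k\ge 3$ be an integer and let $E(2.O_k)$ be the extended graph of the bipartite double of the Odd graph $O_k$. For $0\le i\le k-1$ put $\theta_i^{+}=k-i+(-1)^i$ and $\theta_i^{-}=-(k-i+(-1)^i)$, and let $m(\theta)$ denote the multiplicity of $\theta$ as an eigenvalue of the adjacency matrix of $E(2.O_k)$. Then: (i) $E(2.O_k)$ is an integral graph. (ii) If $k$ is odd, then the eigenvalues of $E(2.O_k)$ are exactly $\theta_i^{+}$ and $\theta_i^{-}$ for $0\le i\le k-1$, and $m(\theta_i^{+})=m(\theta_i^{-})=\binom{2k-1}{i}-\binom{2k-1}{i-1}$ for $0\le i\le k-1$. (iii) If $k$ is even, then the eigenvalues of $E(2.O_k)$ are exactly $\theta_i^{+}$ and $\theta_i^{-}$ for $0\le i\le k-2$ together with $\theta_{k-1}^{+}=\theta_{k-1}^{-}=0$; moreover $m(\theta_i^{+})=m(\theta_i^{-})=\binom{2k-1}{i}-\binom{2k-1}{i-1}$ for $0\le i\le k-2$, and the eigenvalue $\theta_{k-1}^{\pm}=0$ has multiplicity $2\left(\binom{2k-1}{k-1}-\binom{2k-1}{k-2}\right)$.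
   Context: For $k\ge 3$, let $\Omega=\{1,\dots,2k-1\}$. The extended graph $E(2.O_k)$ is the simple graph with vertex set $\{(v,i) : v\subset\Omega,\ |v|=k-1,\ i\in\{0,1\}\}$ in which $(v,i)$ and $(w,j)$ are adjacent if and only if $i\ne j$ and either $v\cap w=\emptyset$ or $v=w$. A graph is integral if all eigenvalues of its adjacency matrix are integers. Convention: $\binom{n}{-1}=0$. *)

theory Defs
  imports
    "Graph_Theory.Pair_Digraph"
    "Jordan_Normal_Form.Spectral_Radius"
begin

section \<open>Spectra of finite simple graphs\<close>

text \<open>
  Finite simple graphs are the digraphs satisfying \<^locale>\<open>pair_graph\<close>: each edge is
  represented by its two opposite arcs. Matrices are indexed by natural numbers, so the adjacency
  matrix depends on a listing of the vertices; a different listing conjugates it by a permutation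
  matrix. The entries are taken to be complex, so that non-real eigenvalues are not excluded by
  the choice of the field.
\<close>

definition vertex_listing :: "'a pair_pre_digraph \<Rightarrow> 'a list \<Rightarrow> bool" where
  "vertex_listing G vs \<longleftrightarrow> distinct vs \<and> set vs = pverts G"

definition adjacency_matrix :: "'a pair_pre_digraph \<Rightarrow> 'a list \<Rightarrow> complex mat" where
  "adjacency_matrix G vs =
     mat (length vs) (length vs) (\<lambda>(i, j). if (vs ! i, vs ! j) \<in> parcs G then 1 else 0)"

definition integral_graph :: "'a pair_pre_digraph \<Rightarrow> bool" where
  "integral_graph G \<longleftrightarrow> pair_graph G \<and>
     (\<forall>vs. vertex_listing G vs \<longrightarrow> (\<forall>\<theta>. eigenvalue (adjacency_matrix G vs) \<theta> \<longrightarrow> \<theta> \<in> \<int>))"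

definition eigenvalue_multiplicity :: "complex mat \<Rightarrow> complex \<Rightarrow> nat" where
  "eigenvalue_multiplicity A \<theta> = Polynomial.order \<theta> (char_poly A)"

lemma pair_fin_digraph_vertex_listing:
  assumes "pair_fin_digraph G"
  shows "\<exists>vs. vertex_listing G vs"
  using finite_distinct_list[OF pair_fin_digraph.pair_finite_verts[OF assms]]
  by (auto simp: vertex_listing_def)


section \<open>The extended graph of the bipartite double of the Odd graph\<close>

definition extended_vertices :: "nat \<Rightarrow> (nat set \<times> nat) set" where
  "extended_vertices k = {(v, i). v \<subseteq> {1..2 * k - 1} \<and> card v = k - 1 \<and> i \<in> {0, 1}}"

definition extended_graph :: "nat \<Rightarrow> (nat set \<times> nat) pair_pre_digraph" where
  "extended_graph k =
     \<lparr> pverts = extended_vertices k,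
       parcs = {((v, i), (w, j)). (v, i) \<in> extended_vertices k \<and> (w, j) \<in> extended_vertices k \<and>
                  i \<noteq> j \<and> (v \<inter> w = {} \<or> v = w)} \<rparr>"

lemma finite_extended_vertices: "finite (extended_vertices k)"
proof (rule finite_subset)
  show "extended_vertices k \<subseteq> Pow {1..2 * k - 1} \<times> {0, 1}"
    by (auto simp: extended_vertices_def)
qed simp

lemma pair_graph_extended_graph: "pair_graph (extended_graph k)"
proof
  show "finite (parcs (extended_graph k))"
    by (rule finite_subset[of _ "extended_vertices k \<times> extended_vertices k"])
      (auto simp: extended_graph_def finite_extended_vertices)
  show "symmetric (with_proj (extended_graph k))"
    by (auto simp: extended_graph_def symmetric_def sym_def)
qed (auto simp: extended_graph_def finite_extended_vertices)

definition theta_plus :: "nat \<Rightarrow> nat \<Rightarrow> int" where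
  "theta_plus k i = int k - int i + (-1) ^ i"

definition theta_minus :: "nat \<Rightarrow> nat \<Rightarrow> int" where
  "theta_minus k i = - (int k - int i + (-1) ^ i)"

text \<open>The lower index is an integer, so that the convention for the lower index \<open>-1\<close> applies.\<close>

definition binom :: "nat \<Rightarrow> int \<Rightarrow> int" where
  "binom n j = (if j < 0 then 0 else int (n choose nat j))"

end

theory Submission
  imports Defs
begin

text \<open>
  Write \<open>O\<close> for the adjacency matrix of the Odd graph. The graph is bipartite, and its adjacency matrix
  has two off-diagonal blocks \<open>O + I\<close>; it is therefore conjugate to the block diagonal matrix of \<open>O + I\<close>
  and \<open>- (O + I)\<close> (\<open>char_poly_bipartite_double\<close>). Everything comes down to the characteristic
  polynomial of \<open>O\<close>, whose eigenvalues are \<open>(-1)\<^sup>i (k - i)\<close>.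

  This polynomial is found by descending from larger to smaller sets, without constructing
  eigenvectors. Consider the matrices on the \<open>j\<close>-subsets of an \<open>n\<close>-set whose entry at \<open>v\<close>, \<open>w\<close> depends
  only on \<open>card (v \<inter> w)\<close>, expanded as a combination of the binomial coefficients of \<open>card (v \<inter> w)\<close> over
  \<open>l \<le> j\<close>. The term \<open>l = j\<close> is a multiple \<open>c I\<close> of the identity, while all other terms factor through the
  \<open>(j - 1)\<close>-subsets, so the matrix has the form \<open>c I + U X\<close> with \<open>U\<close> the inclusion matrix. The matrix
  \<open>c I + X U\<close> on the \<open>(j - 1)\<close>-subsets is again of the kind considered, with coefficients given by a
  simple recurrence. Since \<open>U X\<close> and \<open>X U\<close> have the same nonzero eigenvalues, passing from \<open>j\<close> to
  \<open>j - 1\<close> removes precisely the eigenvalue \<open>c\<close>, with multiplicity the difference of the numbers of \<open>j\<close>-sets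
  and \<open>(j - 1)\<close>-sets (\<open>char_poly_index_mat_commute\<close>, \<open>char_poly_binomial_sum\<close>). The eigenvalues are the
  top coefficients met on the way down. For the disjointness matrix inclusion-exclusion gives the
  initial coefficients \<open>(-1)\<^sup>l\<close>, and solving the recurrence yields \<open>(-1)\<^sup>i (k - i)\<close>
  (\<open>char_poly_disjointness\<close>).

  The eigenvalues of \<open>O + I\<close> and \<open>- (O + I)\<close> pair up to \<open>theta_plus k i\<close> and \<open>theta_minus k i\<close>. By parity and
  monotonicity the values \<open>theta_plus k i\<close> are distinct and nonnegative, and only for even \<open>k\<close> and \<open>i = k - 1\<close>
  is one of them \<open>0\<close>; there the two signs coincide and the multiplicity doubles.
\<close>

section \<open>Characteristic polynomials of products in either order\<close>

text \<open>
  Both sides are the determinant of the block matrix with rows \<open>(c I, A)\<close> and \<open>(B, I)\<close>, scaled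
  by \<open>c\<^sup>m\<close>: multiplying it on the right by \<open>L\<close> clears the lower left block, and multiplying it on the
  left by \<open>R\<close>, whose determinant is \<open>c\<^sup>m\<close>, clears that block as well.
\<close>

lemma det_mult_commute_shift:
  fixes A B :: "'a :: idom mat"
  assumes A: "A \<in> carrier_mat n m" and B: "B \<in> carrier_mat m n"
  shows "det (c \<cdot>\<^sub>m 1\<^sub>m n - A * B) * c ^ m = det (c \<cdot>\<^sub>m 1\<^sub>m m - B * A) * c ^ n"
proof -
  define M where "M = four_block_mat (c \<cdot>\<^sub>m 1\<^sub>m n) A B (1\<^sub>m m)"
  define L where "L = four_block_mat (1\<^sub>m n) (0\<^sub>m n m) (- B) (1\<^sub>m m)"
  define R where "R = four_block_mat (1\<^sub>m n) (0\<^sub>m n m) (- B) (c \<cdot>\<^sub>m 1\<^sub>m m)"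
  have carr: "M \<in> carrier_mat (n + m) (n + m)" "L \<in> carrier_mat (n + m) (n + m)"
    "R \<in> carrier_mat (n + m) (n + m)"
    unfolding M_def L_def R_def by (auto intro!: four_block_carrier_mat)
  have AB: "A * B \<in> carrier_mat n n" and BA: "B * A \<in> carrier_mat m m"
    using A B by auto
  have cB: "(c \<cdot>\<^sub>m 1\<^sub>m m) * B = c \<cdot>\<^sub>m B"
    using mult_smult_assoc_mat[OF one_carrier_mat B, of c] B by simp
  have Bc: "B * (c \<cdot>\<^sub>m 1\<^sub>m n) = c \<cdot>\<^sub>m B"
    using mult_smult_distrib[OF B one_carrier_mat, of c] B by simp
  have "M * L = four_block_mat (c \<cdot>\<^sub>m 1\<^sub>m n - A * B) A (0\<^sub>m m n) (1\<^sub>m m)"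
    unfolding M_def L_def using A B AB
    by (subst mult_four_block_mat[of _ n n _ m _ m _ _ n _ m])
      (auto simp: minus_add_uminus_mat[of _ n n])
  then have det_ML: "det (M * L) = det (c \<cdot>\<^sub>m 1\<^sub>m n - A * B)"
    using det_four_block_mat_lower_left_zero[OF _ A refl one_carrier_mat] minus_carrier_mat[OF AB] by simp
  have "R * M = four_block_mat (c \<cdot>\<^sub>m 1\<^sub>m n) A (0\<^sub>m m n) (c \<cdot>\<^sub>m 1\<^sub>m m - B * A)"
    unfolding M_def R_def using A B BA
    by (subst mult_four_block_mat[of _ n n _ m _ m _ _ n _ m])
      (auto simp: cB Bc minus_add_uminus_mat[of _ m m] comm_add_mat[of _ m m])
  then have det_RM: "det (R * M) = c ^ n * det (c \<cdot>\<^sub>m 1\<^sub>m m - B * A)"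
    using det_four_block_mat_lower_left_zero[OF _ A refl, of "c \<cdot>\<^sub>m 1\<^sub>m n" "c \<cdot>\<^sub>m 1\<^sub>m m - B * A"]
      minus_carrier_mat[OF BA] by simp
  have L: "det L = 1"
    unfolding L_def using B by (subst det_four_block_mat_upper_right_zero[of _ n _ m]) auto
  have R: "det R = c ^ m"
    unfolding R_def using B by (subst det_four_block_mat_upper_right_zero[of _ n _ m]) auto
  show ?thesis
    using det_ML det_RM L R det_mult[OF carr(1,2)] det_mult[OF carr(3,1)] by (simp add: mult.commute)
qed

text \<open>
  Products of matrices indexed by combinatorial objects are sums over these objects; keeping the
  lists of row and column indices explicit lets the entries be manipulated as functions of the
  objects and not of their positions.
\<close>

definition index_mat :: "'a list \<Rightarrow> 'b list \<Rightarrow> ('a \<Rightarrow> 'b \<Rightarrow> 'c) \<Rightarrow> 'c mat" where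
  "index_mat xs ys f = mat (length xs) (length ys) (\<lambda>(i, j). f (xs ! i) (ys ! j))"

lemma index_mat_carrier [simp]: "index_mat xs ys f \<in> carrier_mat (length xs) (length ys)"
  by (simp add: index_mat_def)

lemma index_mat_cong:
  assumes "\<And>x y. x \<in> set xs \<Longrightarrow> y \<in> set ys \<Longrightarrow> f x y = g x y"
  shows "index_mat xs ys f = index_mat xs ys g"
  using assms by (auto simp: index_mat_def intro!: cong_mat)

lemma index_mat_mult:
  assumes "distinct ys"
  shows "index_mat xs ys f * index_mat ys zs g =
    index_mat xs zs (\<lambda>x z. \<Sum>y\<in>set ys. f x y * g y z)"
proof (rule eq_matI)
  fix i j
  assume "i < dim_row (index_mat xs zs (\<lambda>x z. \<Sum>y\<in>set ys. f x y * g y z))"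
    and "j < dim_col (index_mat xs zs (\<lambda>x z. \<Sum>y\<in>set ys. f x y * g y z))"
  then have ij: "i < length xs" "j < length zs"
    by (auto simp: index_mat_def)
  have "(\<Sum>y\<in>set ys. f (xs ! i) y * g y (zs ! j)) =
      (\<Sum>l = 0..<length ys. f (xs ! i) (ys ! l) * g (ys ! l) (zs ! j))"
    using assms bij_betw_nth[OF assms refl refl]
    by (intro sum.reindex_bij_betw[symmetric]) (simp add: atLeast0LessThan)
  with ij show "(index_mat xs ys f * index_mat ys zs g) $$ (i, j) =
      index_mat xs zs (\<lambda>x z. \<Sum>y\<in>set ys. f x y * g y z) $$ (i, j)"
    by (simp add: index_mat_def scalar_prod_def)
qed (auto simp: index_mat_def)

lemma const_poly_sum: "[:sum h A:] = (\<Sum>a\<in>A. [:h a:])"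
proof (induction A rule: infinite_finite_induct)
  case (insert a A)
  then show ?case by (simp flip: insert.IH)
qed simp_all

lemma char_poly_matrix_index_mat:
  fixes f :: "'a \<Rightarrow> 'b \<Rightarrow> 'c :: idom"
  assumes "distinct xs" and "distinct ys"
    and p: "\<And>x x'. x \<in> set xs \<Longrightarrow> x' \<in> set xs \<Longrightarrow>
      p x x' = (if x = x' then c else 0) + (\<Sum>y\<in>set ys. f x y * g y x')"
  shows "char_poly_matrix (index_mat xs xs p) =
      [:- c, 1:] \<cdot>\<^sub>m 1\<^sub>m (length xs) -
      index_mat xs ys (\<lambda>x y. [:f x y:]) * index_mat ys xs (\<lambda>y x. [:g y x:])"
  unfolding index_mat_mult[OF \<open>distinct ys\<close>]
  by (rule eq_matI)
    (auto simp: char_poly_matrix_def index_mat_def p sum_negf mult.commute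
      nth_eq_iff_index_eq[OF \<open>distinct xs\<close>] simp flip: const_poly_sum)

text \<open>
  The determinant identity above, applied to the matrices \<open>f\<close> and \<open>g\<close> with \<open>x - c\<close> in place of \<open>c\<close>,
  compares the characteristic polynomials of \<open>c I + f g\<close> and \<open>c I + g f\<close>. It serves twice: with index
  sets of different sizes it isolates an eigenvalue, and with \<open>c = 0\<close> and index sets of equal size
  it replaces a similarity argument, including the independence of the order of the indices.
\<close>

lemma char_poly_index_mat_commute:
  fixes f :: "'a \<Rightarrow> 'b \<Rightarrow> 'c :: idom"
  assumes xs: "distinct xs" and ys: "distinct ys"
    and p: "\<And>x x'. x \<in> set xs \<Longrightarrow> x' \<in> set xs \<Longrightarrow>
      p x x' = (if x = x' then c else 0) + (\<Sum>y\<in>set ys. f x y * g y x')"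
    and q: "\<And>y y'. y \<in> set ys \<Longrightarrow> y' \<in> set ys \<Longrightarrow>
      q y y' = (if y = y' then c else 0) + (\<Sum>x\<in>set xs. g y x * f x y')"
  shows "char_poly (index_mat xs xs p) * [:- c, 1:] ^ length ys =
    char_poly (index_mat ys ys q) * [:- c, 1:] ^ length xs"
  unfolding char_poly_def char_poly_matrix_index_mat[OF xs ys p, simplified]
    char_poly_matrix_index_mat[OF ys xs q, simplified]
  by (rule det_mult_commute_shift) simp_all

section \<open>Sums over the neighbours of a set in the subset lattice\<close>

text \<open>
  The sets in the sum are \<open>v - {a}\<close> with \<open>a \<in> v\<close>; the intersection with \<open>w\<close> loses an element exactly when
  \<open>a \<in> w\<close>. When \<open>v \<inter> w\<close> is empty, the truncated argument \<open>card (v \<inter> w) - 1\<close> comes with the factor \<open>0\<close>.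
\<close>

lemma sum_over_deletions:
  fixes h :: "nat \<Rightarrow> 'b :: comm_ring_1"
  assumes "finite v" "card v = Suc j"
  shows "(\<Sum>y \<in> {y. y \<subseteq> v \<and> card y = j}. h (card (y \<inter> w))) =
    of_nat (Suc j - card (v \<inter> w)) * h (card (v \<inter> w)) +
    of_nat (card (v \<inter> w)) * h (card (v \<inter> w) - 1)"
proof -
  have del: "{y. y \<subseteq> v \<and> card y = j} = (\<lambda>a. v - {a}) ` v"
  proof (intro equalityI subsetI)
    fix y assume "y \<in> {y. y \<subseteq> v \<and> card y = j}"
    then have y: "y \<subseteq> v" "card y = j" by auto
    then have "card (v - y) = 1"
      using assms by (simp add: card_Diff_subset finite_subset)
    then obtain a where "v - y = {a}" by (auto simp: card_1_singleton_iff)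
    with y have "a \<in> v" "y = v - {a}" by auto
    then show "y \<in> (\<lambda>a. v - {a}) ` v" by blast
  qed (use assms in auto)
  have inj: "inj_on (\<lambda>a. v - {a}) v" by (auto simp: inj_on_def)
  have card_del: "card ((v - {a}) \<inter> w) = (if a \<in> w then card (v \<inter> w) - 1 else card (v \<inter> w))"
    if "a \<in> v" for a
  proof -
    have "(v - {a}) \<inter> w = v \<inter> w - {a}" by blast
    with that show ?thesis by (simp add: card_Diff_singleton_if del: Int_Diff)
  qed
  have "(\<Sum>y \<in> {y. y \<subseteq> v \<and> card y = j}. h (card (y \<inter> w))) =
      (\<Sum>a\<in>v. h (card ((v - {a}) \<inter> w)))"
    unfolding del using inj by (simp add: sum.reindex)
  also have "\<dots> = (\<Sum>a\<in>v. if a \<in> w then h (card (v \<inter> w) - 1) else h (card (v \<inter> w)))"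
    by (rule sum.cong) (simp_all add: card_del)
  also have "\<dots> = of_nat (card (v \<inter> w)) * h (card (v \<inter> w) - 1) +
      of_nat (card (v - w)) * h (card (v \<inter> w))"
    using assms by (simp add: sum.If_cases Diff_eq)
  also have "card (v - w) = Suc j - card (v \<inter> w)"
    using assms by (simp add: card_Diff_subset_Int)
  finally show ?thesis by (simp add: add.commute)
qed

text \<open>
  The sets in the sum are \<open>y' \<union> {a}\<close> with \<open>a \<in> \<Omega> - y'\<close>; the intersection with \<open>y\<close> gains an element exactly
  when \<open>a \<in> y - y'\<close>.
\<close>

lemma sum_over_insertions:
  fixes h :: "nat \<Rightarrow> 'b :: comm_ring_1"
  assumes "finite \<Omega>" "y' \<subseteq> \<Omega>" "card y' = j" "y \<subseteq> \<Omega>" "card y = j"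
    "2 * j \<le> card \<Omega>"
  shows "(\<Sum>w \<in> {w. w \<subseteq> \<Omega> \<and> card w = Suc j \<and> y' \<subseteq> w}. h (card (y \<inter> w))) =
    of_nat (j - card (y \<inter> y')) * h (Suc (card (y \<inter> y'))) +
    of_nat (card \<Omega> - 2 * j + card (y \<inter> y')) * h (card (y \<inter> y'))"
proof -
  have fin: "finite y" "finite y'" using assms finite_subset by auto
  have ins: "{w. w \<subseteq> \<Omega> \<and> card w = Suc j \<and> y' \<subseteq> w} = (\<lambda>a. insert a y') ` (\<Omega> - y')"
  proof (intro equalityI subsetI)
    fix w assume "w \<in> {w. w \<subseteq> \<Omega> \<and> card w = Suc j \<and> y' \<subseteq> w}"
    then have w: "w \<subseteq> \<Omega>" "card w = Suc j" "y' \<subseteq> w" by auto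
    then have "card (w - y') = 1"
      using fin assms by (simp add: card_Diff_subset)
    then obtain a where "w - y' = {a}" by (auto simp: card_1_singleton_iff)
    with w have "a \<in> \<Omega> - y'" "w = insert a y'" by auto
    then show "w \<in> (\<lambda>a. insert a y') ` (\<Omega> - y')" by blast
  qed (use fin assms in auto)
  have inj: "inj_on (\<lambda>a. insert a y') (\<Omega> - y')" by (auto simp: inj_on_def)
  have card_ins: "card (y \<inter> insert a y') =
      (if a \<in> y then Suc (card (y \<inter> y')) else card (y \<inter> y'))" if "a \<in> \<Omega> - y'" for a
    using that fin by simp
  have "(\<Sum>w \<in> {w. w \<subseteq> \<Omega> \<and> card w = Suc j \<and> y' \<subseteq> w}. h (card (y \<inter> w))) =
      (\<Sum>a\<in>\<Omega> - y'. h (card (y \<inter> insert a y')))"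
    unfolding ins using inj by (simp add: sum.reindex)
  also have "\<dots> = (\<Sum>a\<in>\<Omega> - y'. if a \<in> y then h (Suc (card (y \<inter> y'))) else h (card (y \<inter> y')))"
    by (rule sum.cong) (simp_all add: card_ins del: Int_insert_right)
  also have "\<dots> = of_nat (card ((\<Omega> - y') \<inter> y)) * h (Suc (card (y \<inter> y'))) +
      of_nat (card (\<Omega> - y' - y)) * h (card (y \<inter> y'))"
    using assms by (simp add: sum.If_cases Diff_eq)
  also have "(\<Omega> - y') \<inter> y = y - y'" using assms by auto
  also have "card (y - y') = j - card (y \<inter> y')"
    using fin assms by (simp add: card_Diff_subset_Int)
  also have "card (\<Omega> - y' - y) = card \<Omega> - 2 * j + card (y \<inter> y')"
  proof -
    have "card (y \<union> y') + card (y \<inter> y') = 2 * j"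
      using card_Un_Int[OF fin] assms by simp
    moreover have "card (\<Omega> - y' - y) = card \<Omega> - card (y \<union> y')"
    proof -
      have "\<Omega> - y' - y = \<Omega> - (y \<union> y')" by blast
      then show ?thesis using assms fin by (simp add: card_Diff_subset)
    qed
    moreover have "card (y \<union> y') \<le> card \<Omega>"
      using assms by (auto intro: card_mono)
    ultimately show ?thesis using assms by linarith
  qed
  finally show ?thesis .
qed

section \<open>Matrices depending on the size of the intersection\<close>

definition layer :: "'a set \<Rightarrow> nat \<Rightarrow> 'a set set" where
  "layer \<Omega> j = {v. v \<subseteq> \<Omega> \<and> card v = j}"

lemma finite_layer [simp]: "finite \<Omega> \<Longrightarrow> finite (layer \<Omega> j)"
  by (rule finite_subset[of _ "Pow \<Omega>"]) (auto simp: layer_def)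

lemma card_layer: "finite \<Omega> \<Longrightarrow> card (layer \<Omega> j) = card \<Omega> choose j"
  unfolding layer_def by (rule n_subsets)

text \<open>
  The binomial coefficient of \<open>card (v \<inter> w)\<close> over \<open>l\<close> counts the \<open>l\<close>-sets contained in both \<open>v\<close> and \<open>w\<close>.
  Hence the matrix with entries \<open>binomial_sum c j (card (v \<inter> w))\<close> on the \<open>j\<close>-sets is the combination
  with coefficients \<open>c l\<close> of the products of an inclusion matrix between \<open>j\<close>-sets and \<open>l\<close>-sets with its
  transpose. In this basis the passage from \<open>j + 1\<close> to \<open>j\<close> is a two-term recurrence for \<open>c\<close>.
\<close>

definition binomial_sum :: "(nat \<Rightarrow> 'a :: field_char_0) \<Rightarrow> nat \<Rightarrow> nat \<Rightarrow> 'a" where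
  "binomial_sum c j t = (\<Sum>l\<le>j. c l * of_nat (t choose l))"

lemma card_Int_layer_eq_iff:
  assumes "finite \<Omega>" "v \<in> layer \<Omega> j" "w \<in> layer \<Omega> j"
  shows "card (v \<inter> w) = j \<longleftrightarrow> v = w"
proof
  assume "card (v \<inter> w) = j"
  moreover have "finite v" "finite w" "card v = j" "card w = j"
    using assms by (auto simp: layer_def finite_subset)
  ultimately have "v \<inter> w = v" "v \<inter> w = w" by (metis Int_lower1 card_subset_eq, metis Int_lower2 card_subset_eq)
  then show "v = w" by simp
qed (use assms in \<open>auto simp: layer_def\<close>)

lemma card_Int_layer_le:
  assumes "finite \<Omega>" "v \<in> layer \<Omega> j"
  shows "card (v \<inter> w) \<le> j"
  using assms card_mono[of v "v \<inter> w"] by (auto simp: layer_def finite_subset)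

text \<open>
  The term \<open>l = j\<close> of a binomial sum is a multiple of the identity matrix: two \<open>j\<close>-sets contain a
  common \<open>j\<close>-set only if they agree.
\<close>

lemma top_binomial_eq_delta:
  assumes "finite \<Omega>" "v \<in> layer \<Omega> j" "w \<in> layer \<Omega> j"
  shows "of_nat (card (v \<inter> w) choose j) = (if v = w then 1 else 0)"
  using card_Int_layer_eq_iff[OF assms] card_Int_layer_le[OF assms(1,2), of w]
  by (cases "v = w") (auto simp: binomial_eq_0)

lemma binomial_deletion:
  assumes "t \<le> Suc j"
  shows "(of_nat (Suc j - t) * of_nat (t choose l) + of_nat t * of_nat ((t - 1) choose l) :: 'a :: field_char_0) =
    (of_nat (Suc j) - of_nat l) * of_nat (t choose l)"
proof (cases "l \<le> t")
  case True
  have "(of_nat t * of_nat ((t - 1) choose l) :: 'a) = of_nat ((t - l) * (t choose l))"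
    by (simp only: binomial_absorb_comp of_nat_mult)
  with True assms show ?thesis by (simp add: of_nat_diff algebra_simps)
qed (simp add: binomial_eq_0)

text \<open>
  Pascal's rule turns the binomial coefficients of \<open>t + 1\<close> into those of \<open>t\<close>, and the absorption identity
  removes the remaining factors \<open>t\<close>. The case distinction is the binomial coefficient of \<open>t\<close> over \<open>l - 1\<close>,
  read as \<open>0\<close> for \<open>l = 0\<close>.
\<close>

lemma binomial_insertion:
  assumes "t \<le> j" "2 * j \<le> n"
  shows "(of_nat (j - t) * of_nat (Suc t choose l) + of_nat (n - 2 * j + t) * of_nat (t choose l) :: 'a :: field_char_0) =
    (of_nat n - of_nat j - of_nat l) * of_nat (t choose l) +
    (of_nat (Suc j) - of_nat l) * (case l of 0 \<Rightarrow> 0 | Suc m \<Rightarrow> of_nat (t choose m))"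
proof (cases l)
  case 0
  with assms show ?thesis by (simp add: of_nat_diff algebra_simps)
next
  case (Suc m)
  have "(of_nat (t choose m) * (of_nat t - of_nat m) :: 'a) =
      of_nat (t choose Suc m) + of_nat m * of_nat (t choose Suc m)"
  proof (cases "m \<le> t")
    case True
    then have "(of_nat (t choose m) * (of_nat t - of_nat m) :: 'a) = of_nat ((t - m) * (t choose m))"
      by (simp add: of_nat_diff)
    also have "(t - m) * (t choose m) = Suc m * (t choose Suc m)"
      by (metis binomial_absorption binomial_absorb_comp)
    finally show ?thesis by (simp add: algebra_simps)
  qed (simp add: binomial_eq_0)
  with Suc assms show ?thesis by (simp add: of_nat_diff algebra_simps)
qed

text \<open>
  Up to the term \<open>l = j + 1\<close>, a binomial sum matrix on the \<open>(j + 1)\<close>-sets factors through the \<open>j\<close>-sets.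
  The divisor \<open>j + 1 - l\<close> is the number of \<open>j\<close>-sets between an \<open>l\<close>-set and a \<open>(j + 1)\<close>-set containing it.
\<close>

lemma sum_inclusion_down:
  fixes c :: "nat \<Rightarrow> 'b :: field_char_0"
  assumes \<Omega>: "finite \<Omega>" and v: "v \<in> layer \<Omega> (Suc j)"
  defines "d \<equiv> \<lambda>l. c l / (of_nat (Suc j) - of_nat l)"
  shows "(\<Sum>y\<in>layer \<Omega> j. (if y \<subseteq> v then 1 else 0) * binomial_sum d j (card (y \<inter> w))) =
    binomial_sum c j (card (v \<inter> w))"
proof -
  let ?t = "card (v \<inter> w)"
  have fin: "finite v" and card: "card v = Suc j"
    using assms by (auto simp: layer_def finite_subset)
  have "(\<Sum>y\<in>layer \<Omega> j. (if y \<subseteq> v then 1 else 0) * binomial_sum d j (card (y \<inter> w))) =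
      (\<Sum>y \<in> {y. y \<subseteq> v \<and> card y = j}. binomial_sum d j (card (y \<inter> w)))"
    using \<Omega> v by (intro sum.mono_neutral_cong_right) (auto simp: layer_def)
  also have "\<dots> = of_nat (Suc j - ?t) * binomial_sum d j ?t + of_nat ?t * binomial_sum d j (?t - 1)"
    by (rule sum_over_deletions[OF fin card])
  also have "\<dots> = (\<Sum>l\<le>j. d l * (of_nat (Suc j - ?t) * of_nat (?t choose l) +
      of_nat ?t * of_nat ((?t - 1) choose l)))"
    unfolding binomial_sum_def sum_distrib_left sum.distrib[symmetric]
    by (rule sum.cong) (simp_all only: distrib_left mult_ac)
  also have "\<dots> = binomial_sum c j ?t"
    unfolding binomial_sum_def
  proof (rule sum.cong)
    fix l assume "l \<in> {..j}"
    then have "(of_nat (Suc j) :: 'b) \<noteq> of_nat l" by (simp only: of_nat_eq_iff) simp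
    then show "d l * (of_nat (Suc j - ?t) * of_nat (?t choose l) +
        of_nat ?t * of_nat ((?t - 1) choose l)) = c l * of_nat (?t choose l)"
      unfolding binomial_deletion[OF card_Int_layer_le[OF \<Omega> v]] d_def by simp
  qed simp
  finally show ?thesis .
qed

text \<open>
  The factors of the preceding lemma, multiplied in the other order, give a matrix on the \<open>j\<close>-sets
  that is a binomial sum again. The multiple of the identity can be absorbed into its term \<open>l = j\<close>, so
  that one formula describes all new coefficients.
\<close>

lemma sum_inclusion_up:
  fixes c :: "nat \<Rightarrow> 'b :: field_char_0"
  assumes \<Omega>: "finite \<Omega>" "2 * j \<le> card \<Omega>" and y: "y \<in> layer \<Omega> j" and y': "y' \<in> layer \<Omega> j"
  defines "d \<equiv> \<lambda>l. c l / (of_nat (Suc j) - of_nat l)"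
  shows "(if y = y' then c (Suc j) else 0) +
    (\<Sum>w\<in>layer \<Omega> (Suc j). binomial_sum d j (card (y \<inter> w)) * (if y' \<subseteq> w then 1 else 0)) =
    binomial_sum (\<lambda>l. c l * (of_nat (card \<Omega>) - of_nat j - of_nat l) / (of_nat (Suc j) - of_nat l)
      + c (Suc l)) j (card (y \<inter> y'))"
proof -
  let ?t = "card (y \<inter> y')" and ?n = "card \<Omega>"
  have t: "?t \<le> j" by (rule card_Int_layer_le[OF \<Omega>(1) y])
  have cancel: "r \<noteq> 0 \<Longrightarrow> x / r * (m * a + r * b) = x * m / r * a + x * b" for x r m a b :: 'b
    by (simp add: field_simps)
  have "(\<Sum>w\<in>layer \<Omega> (Suc j). binomial_sum d j (card (y \<inter> w)) * (if y' \<subseteq> w then 1 else 0)) =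
      (\<Sum>w \<in> {w. w \<subseteq> \<Omega> \<and> card w = Suc j \<and> y' \<subseteq> w}. binomial_sum d j (card (y \<inter> w)))"
    using \<Omega> by (intro sum.mono_neutral_cong_right) (auto simp: layer_def)
  also have "\<dots> = of_nat (j - ?t) * binomial_sum d j (Suc ?t) +
      of_nat (?n - 2 * j + ?t) * binomial_sum d j ?t"
    using y y' \<Omega> by (intro sum_over_insertions) (auto simp: layer_def)
  also have "\<dots> = (\<Sum>l\<le>j. d l * (of_nat (j - ?t) * of_nat (Suc ?t choose l) +
      of_nat (?n - 2 * j + ?t) * of_nat (?t choose l)))"
    unfolding binomial_sum_def sum_distrib_left sum.distrib[symmetric]
    by (rule sum.cong) (simp_all only: distrib_left mult_ac)
  also have "\<dots> = (\<Sum>l\<le>j. c l * (of_nat ?n - of_nat j - of_nat l) / (of_nat (Suc j) - of_nat l) *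
      of_nat (?t choose l) + c l * (case l of 0 \<Rightarrow> 0 | Suc m \<Rightarrow> of_nat (?t choose m)))"
  proof (rule sum.cong)
    fix l assume "l \<in> {..j}"
    then have "(of_nat (Suc j) :: 'b) \<noteq> of_nat l" by (simp only: of_nat_eq_iff) simp
    then have "of_nat (Suc j) - of_nat l \<noteq> (0 :: 'b)" by simp
    then show "d l * (of_nat (j - ?t) * of_nat (Suc ?t choose l) +
        of_nat (?n - 2 * j + ?t) * of_nat (?t choose l)) =
      c l * (of_nat ?n - of_nat j - of_nat l) / (of_nat (Suc j) - of_nat l) *
      of_nat (?t choose l) + c l * (case l of 0 \<Rightarrow> 0 | Suc m \<Rightarrow> of_nat (?t choose m))"
      unfolding binomial_insertion[OF t \<Omega>(2)] d_def by (rule cancel)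
  qed simp
  finally have sum_eq: "(\<Sum>w\<in>layer \<Omega> (Suc j). binomial_sum d j (card (y \<inter> w)) * (if y' \<subseteq> w then 1 else 0)) =
      (\<Sum>l\<le>j. c l * (of_nat ?n - of_nat j - of_nat l) / (of_nat (Suc j) - of_nat l) *
      of_nat (?t choose l)) + (\<Sum>l\<le>j. c l * (case l of 0 \<Rightarrow> 0 | Suc m \<Rightarrow> of_nat (?t choose m)))"
    by (simp add: sum.distrib)
  have "(if y = y' then c (Suc j) else 0) = c (Suc j) * of_nat (?t choose j)"
    by (simp add: top_binomial_eq_delta[OF \<Omega>(1) y y'])
  moreover have "(\<Sum>l\<le>j. c l * (case l of 0 \<Rightarrow> 0 | Suc m \<Rightarrow> of_nat (?t choose m))) +
      c (Suc j) * of_nat (?t choose j) = (\<Sum>l\<le>j. c (Suc l) * of_nat (?t choose l))"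
    by (induction j) (simp_all add: add.assoc)
  ultimately show ?thesis
    unfolding sum_eq by (simp add: binomial_sum_def distrib_right sum.distrib add_ac)
qed

text \<open>
  The dimension of the space of functions on the \<open>i\<close>-subsets of an \<open>n\<close>-set whose sums over all
  \<open>i\<close>-sets containing a given \<open>(i - 1)\<close>-set vanish, for \<open>2 * i \<le> n\<close>.
\<close>

definition harmonic_dim :: "nat \<Rightarrow> nat \<Rightarrow> nat" where
  "harmonic_dim n i = (case i of 0 \<Rightarrow> 1 | Suc m \<Rightarrow> (n choose i) - (n choose m))"

text \<open>
  By the two preceding factorizations, the matrix on the \<open>(j + 1)\<close>-sets is \<open>c I + up * down\<close> and the one on
  the \<open>j\<close>-sets is \<open>c I + down * up\<close>, where \<open>c\<close> is the top coefficient \<open>c (j + 1) (j + 1)\<close>. Hence the former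
  has the eigenvalues of the latter and in addition \<open>c\<close>, as often as there are more \<open>(j + 1)\<close>-sets than
  \<open>j\<close>-sets. The eigenvalues are thus the top coefficients of all levels.
\<close>

lemma char_poly_binomial_sum:
  fixes c :: "nat \<Rightarrow> nat \<Rightarrow> 'b :: field_char_0"
  assumes \<Omega>: "finite \<Omega>" and "2 * j \<le> card \<Omega>"
    and rec: "\<And>i l. i < j \<Longrightarrow> l \<le> i \<Longrightarrow> c i l =
      c (Suc i) l * (of_nat (card \<Omega>) - of_nat i - of_nat l) / (of_nat (Suc i) - of_nat l) + c (Suc i) (Suc l)"
    and "distinct xs" and "set xs = layer \<Omega> j"
  shows "char_poly (index_mat xs xs (\<lambda>v w. binomial_sum (c j) j (card (v \<inter> w)))) =
    (\<Prod>i\<le>j. [:- c i i, 1:] ^ harmonic_dim (card \<Omega>) i)"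
  using assms(2-)
proof (induction j arbitrary: xs)
  case 0
  have "layer \<Omega> 0 = {{}}" using \<Omega> by (auto simp: layer_def finite_subset)
  with 0 have "set xs = {{}}" "length xs = 1" using distinct_card[of xs] by simp_all
  then obtain v where "xs = [v]" by (metis One_nat_def length_0_conv length_Suc_conv)
  with \<open>set xs = {{}}\<close> have "xs = [{}]" by simp
  then show ?case
    by (simp add: binomial_sum_def index_mat_def char_poly_def char_poly_matrix_def harmonic_dim_def det_single)
next
  case (Suc j)
  obtain ys where ys: "distinct ys" "set ys = layer \<Omega> j"
    using finite_distinct_list[OF finite_layer[OF \<Omega>]] by metis
  let ?p = "\<lambda>v w. binomial_sum (c (Suc j)) (Suc j) (card (v \<inter> w))"
    and ?q = "\<lambda>v w. binomial_sum (c j) j (card (v \<inter> w))" and ?L = "[:- c (Suc j) (Suc j), 1:]"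
  define d where "d = (\<lambda>l. c (Suc j) l / (of_nat (Suc j) - of_nat l))"
  define up :: "'a set \<Rightarrow> 'a set \<Rightarrow> 'b" where "up = (\<lambda>v y. if y \<subseteq> v then 1 else 0)"
  define down where "down = (\<lambda>y w :: 'a set. binomial_sum d j (card (y \<inter> w)))"
  have p: "?p v w = (if v = w then c (Suc j) (Suc j) else 0) + (\<Sum>y\<in>set ys. up v y * down y w)"
    if "v \<in> set xs" "w \<in> set xs" for v w
  proof -
    have vw: "v \<in> layer \<Omega> (Suc j)" "w \<in> layer \<Omega> (Suc j)" using that Suc.prems by auto
    have "?p v w = c (Suc j) (Suc j) * of_nat (card (v \<inter> w) choose Suc j) +
        binomial_sum (c (Suc j)) j (card (v \<inter> w))"
      by (simp add: binomial_sum_def)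
    with vw show ?thesis
      unfolding up_def down_def d_def ys sum_inclusion_down[OF \<Omega> vw(1)]
      by (simp add: top_binomial_eq_delta[OF \<Omega>] del: binomial_Suc_Suc)
  qed
  have q: "?q y y' = (if y = y' then c (Suc j) (Suc j) else 0) + (\<Sum>w\<in>set xs. down y w * up w y')"
    if "y \<in> set ys" "y' \<in> set ys" for y y'
  proof -
    have "?q y y' = binomial_sum (\<lambda>l. c (Suc j) l * (of_nat (card \<Omega>) - of_nat j - of_nat l) /
        (of_nat (Suc j) - of_nat l) + c (Suc j) (Suc l)) j (card (y \<inter> y'))"
      unfolding binomial_sum_def using Suc.prems(2)[of j] by (intro sum.cong) simp_all
    also have "\<dots> = (if y = y' then c (Suc j) (Suc j) else 0) + (\<Sum>w\<in>set xs. down y w * up w y')"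
      using sum_inclusion_up[OF \<Omega> _, of j y y' "c (Suc j)"] that Suc.prems ys
      by (simp add: up_def down_def d_def)
    finally show ?thesis .
  qed
  have len: "length xs = card \<Omega> choose Suc j" "length ys = card \<Omega> choose j"
    using Suc.prems ys distinct_card[of xs] distinct_card[of ys] by (simp_all add: card_layer \<Omega>)
  have le: "card \<Omega> choose j \<le> card \<Omega> choose Suc j"
    using Suc.prems by (intro binomial_mono) auto
  have "char_poly (index_mat xs xs ?p) * ?L ^ length ys = char_poly (index_mat ys ys ?q) * ?L ^ length xs"
    by (rule char_poly_index_mat_commute[OF \<open>distinct xs\<close> ys(1) p q])
  also have "\<dots> = char_poly (index_mat ys ys ?q) * ?L ^ harmonic_dim (card \<Omega>) (Suc j) * ?L ^ length ys"
    using le by (simp add: len harmonic_dim_def mult.assoc flip: power_add)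
  finally have "char_poly (index_mat xs xs ?p) = char_poly (index_mat ys ys ?q) * ?L ^ harmonic_dim (card \<Omega>) (Suc j)"
    by simp
  also have "char_poly (index_mat ys ys ?q) = (\<Prod>i\<le>j. [:- c i i, 1:] ^ harmonic_dim (card \<Omega>) i)"
    using Suc.prems ys by (intro Suc.IH) auto
  finally show ?case by (simp add: mult.commute)
qed

section \<open>The Odd graph\<close>

text \<open>
  Inclusion-exclusion: this writes the disjointness matrix as a binomial sum.
\<close>

lemma binomial_sum_alternating:
  assumes "t \<le> m"
  shows "binomial_sum (\<lambda>l. (-1) ^ l) m t = (if t = 0 then 1 else 0)"
proof -
  have "binomial_sum (\<lambda>l. (-1) ^ l) m t = (\<Sum>l\<le>t. (-1) ^ l * of_nat (t choose l) :: 'a)"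
    unfolding binomial_sum_def using assms
    by (intro sum.mono_neutral_right) (auto simp: binomial_eq_0)
  then show ?thesis by (simp add: choose_alternating_sum)
qed

text \<open>
  The case \<open>a = 1\<close>, \<open>b = 0\<close> is the Odd graph. The coefficients \<open>a (-1)\<^sup>l\<close> at the top level \<open>m\<close> and the
  recurrence determine those at the lower levels; the closed form \<open>c\<close> in the proof solves it. The
  multiple \<open>b\<close> of the identity only contributes to the coefficients with \<open>l = i\<close> and is passed on
  unchanged from level to level.
\<close>

lemma char_poly_disjointness:
  fixes a b :: "'b :: field_char_0"
  assumes \<Omega>: "finite \<Omega>" "card \<Omega> = 2 * m + 1" and xs: "distinct xs" "set xs = layer \<Omega> m"
  shows "char_poly (index_mat xs xs (\<lambda>v w. (if v \<inter> w = {} then a else 0) + (if v = w then b else 0))) =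
    (\<Prod>i\<le>m. [:- (a * (-1) ^ i * of_nat (Suc m - i) + b), 1:] ^ harmonic_dim (2 * m + 1) i)"
proof -
  define c where "c = (\<lambda>i l. a * (-1) ^ l * fact (Suc m - i) * fact (i - l) / fact (m - l) +
    (if l = i then b else 0))"
  have top: "binomial_sum (c m) m (card (v \<inter> w)) = (if v \<inter> w = {} then a else 0) + (if v = w then b else 0)"
    if "v \<in> layer \<Omega> m" "w \<in> layer \<Omega> m" for v w
  proof -
    let ?t = "card (v \<inter> w)"
    have "finite v" using that \<Omega> by (auto simp: layer_def finite_subset)
    have "binomial_sum (c m) m ?t = (\<Sum>l\<le>m. a * ((-1) ^ l * of_nat (?t choose l)) +
        (if l = m then b * of_nat (?t choose m) else 0))"
      unfolding binomial_sum_def by (rule sum.cong) (auto simp: c_def algebra_simps)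
    also have "\<dots> = a * binomial_sum (\<lambda>l. (-1) ^ l) m ?t + b * of_nat (?t choose m)"
      by (simp add: sum.distrib binomial_sum_def flip: sum_distrib_left)
    finally show ?thesis
      using binomial_sum_alternating[OF card_Int_layer_le[OF \<Omega>(1) that(1)], where 'a = 'b] \<open>finite v\<close>
      by (simp add: top_binomial_eq_delta[OF \<Omega>(1) that])
  qed
  have rec: "c i l = c (Suc i) l * (of_nat (card \<Omega>) - of_nat i - of_nat l) / (of_nat (Suc i) - of_nat l)
      + c (Suc i) (Suc l)" if il: "i < m" "l \<le> i" for i l
  proof -
    \<comment> \<open>In terms of \<open>s = i - l\<close> and \<open>r = m - i - 1\<close> all subtractions disappear. The identity then comes
      down to \<open>(s + r + 1) + (r + 2) - (s + r + 1) = r + 2\<close>, the step from \<open>fact (r + 1)\<close> to \<open>fact (r + 2)\<close>.\<close>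
    obtain s where i: "i = l + s" using il(2) le_Suc_ex by blast
    obtain r where m: "m = Suc (i + r)" using il(1) less_imp_Suc_add by blast
    have nz: "(of_nat (Suc s) :: 'b) \<noteq> 0" "(of_nat (Suc (s + r)) :: 'b) \<noteq> 0"
      by (simp_all only: of_nat_eq_0_iff)
    have idx: "Suc m - i = Suc (Suc r)" "i - l = s" "m - l = Suc (s + r)" "Suc m - Suc i = Suc r"
      "Suc i - l = Suc s" "m - Suc l = s + r" "Suc i - Suc l = s"
      using i m by auto
    have diff: "of_nat (card \<Omega>) - of_nat i - of_nat l = (of_nat (Suc (s + r)) + of_nat (Suc (Suc r)) :: 'b)"
      "of_nat (Suc i) - of_nat l = (of_nat (Suc s) :: 'b)"
      using i m \<Omega>(2) by simp_all
    show ?thesis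
      unfolding c_def idx diff fact_Suc of_nat_mult using nz il
      by (simp add: divide_simps del: of_nat_Suc) (simp add: algebra_simps)
  qed
  have diag: "c i i = a * (-1) ^ i * of_nat (Suc m - i) + b" if "i \<le> m" for i
    using that by (simp add: c_def Suc_diff_le)
  have "index_mat xs xs (\<lambda>v w. (if v \<inter> w = {} then a else 0) + (if v = w then b else 0)) =
      index_mat xs xs (\<lambda>v w. binomial_sum (c m) m (card (v \<inter> w)))"
    using xs by (intro index_mat_cong) (simp add: top)
  then show ?thesis
    using char_poly_binomial_sum[OF \<Omega>(1) _ rec xs] \<Omega>(2) by (simp add: diag)
qed

section \<open>Bipartite doubles\<close>

lemma char_poly_index_mat_append:
  fixes f :: "'a \<Rightarrow> 'a \<Rightarrow> 'b :: idom"
  assumes "\<And>x y. x \<in> set xs \<Longrightarrow> y \<in> set ys \<Longrightarrow> f y x = 0"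
  shows "char_poly (index_mat (xs @ ys) (xs @ ys) f) =
    char_poly (index_mat xs xs f) * char_poly (index_mat ys ys f)"
proof -
  have "char_poly_matrix (index_mat (xs @ ys) (xs @ ys) f) =
      four_block_mat (char_poly_matrix (index_mat xs xs f)) (index_mat xs ys (\<lambda>x y. [:- f x y:]))
        (0\<^sub>m (length ys) (length xs)) (char_poly_matrix (index_mat ys ys f))"
    by (rule eq_matI) (auto simp: char_poly_matrix_def index_mat_def nth_append assms)
  then show ?thesis
    unfolding char_poly_def
    by (simp add: det_four_block_mat_lower_left_zero[OF char_poly_matrix_closed _ refl char_poly_matrix_closed])
qed

lemma index_mat_map: "index_mat (map h xs) (map k ys) f = index_mat xs ys (\<lambda>x y. f (h x) (k y))"
  by (auto simp: index_mat_def)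

text \<open>
  The matrix with blocks \<open>(0, B)\<close> and \<open>(B, 0)\<close> is conjugate to the block diagonal matrix with blocks \<open>B\<close>
  and \<open>- B\<close> through the matrix with blocks \<open>(I, I)\<close> and \<open>(I, - I)\<close>, which is twice its own inverse.
\<close>

lemma char_poly_bipartite_double:
  fixes B :: "'a \<Rightarrow> 'a \<Rightarrow> 'b :: field_char_0"
  assumes xs: "distinct xs" and vs: "distinct vs" "set vs = set xs \<times> {0, 1 :: nat}"
  shows "char_poly (index_mat vs vs (\<lambda>(v, i) (w, j). if i \<noteq> j then B v w else 0)) =
    char_poly (index_mat xs xs B) * char_poly (index_mat xs xs (\<lambda>v w. - B v w))"
proof -
  \<comment> \<open>\<open>F\<close> is the block diagonal matrix, \<open>f\<close> the conjugating matrix and \<open>g\<close> the product of \<open>F\<close> with the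
    inverse of \<open>f\<close>, so that the two matrices are \<open>f g\<close> and \<open>g f\<close>.\<close>
  define ws where "ws = map (\<lambda>v. (v, 0 :: nat)) xs @ map (\<lambda>v. (v, 1)) xs"
  define F where "F = (\<lambda>(v, i :: nat) (w, j). if i = j then (-1) ^ i * B v w else 0)"
  define f where "f = (\<lambda>(v :: 'a, i :: nat) (w, j :: nat). if v = w then (-1) ^ (i * j) else 0 :: 'b)"
  define g where "g = (\<lambda>(v :: 'a, i :: nat) (w, j :: nat). (-1) ^ i * (-1) ^ (i * j) * B v w / 2)"
  have ws: "distinct ws" "set ws = set xs \<times> {0, 1}"
    using xs by (auto simp: ws_def distinct_map inj_on_def)
  have sum: "(\<Sum>z\<in>set xs \<times> {0, 1}. h z) = (\<Sum>v\<in>set xs. h (v, 0) + h (v, 1))" for h :: "'a \<times> nat \<Rightarrow> 'b"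
    by (simp add: sum.cartesian_product')
  have fg: "(\<lambda>(v, i) (w, j). if i \<noteq> j then B v w else 0) z z' =
      (if z = z' then 0 else 0) + (\<Sum>y\<in>set ws. f z y * g y z')"
    if "z \<in> set vs" "z' \<in> set vs" for z z'
    using that unfolding vs ws sum
    by (auto simp: f_def g_def sum.distrib sum_negf if_distrib[of "\<lambda>x. x * _"]
      cong: if_cong simp flip: sum_divide_distrib)
  have gf: "F z z' = (if z = z' then 0 else 0) + (\<Sum>y\<in>set vs. g z y * f y z')"
    if "z \<in> set ws" "z' \<in> set ws" for z z'
    using that unfolding vs ws sum
    by (auto simp: F_def f_def g_def sum.distrib if_distrib[of "\<lambda>x. _ * x"] cong: if_cong)
  have "length vs = length ws"
    using vs ws by (metis distinct_card)
  with char_poly_index_mat_commute[OF vs(1) ws(1) fg gf]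
  have "char_poly (index_mat vs vs (\<lambda>(v, i) (w, j). if i \<noteq> j then B v w else 0)) =
      char_poly (index_mat ws ws F)" by simp
  also have "\<dots> = char_poly (index_mat xs xs B) * char_poly (index_mat xs xs (\<lambda>v w. - B v w))"
    unfolding ws_def by (subst char_poly_index_mat_append) (auto simp: index_mat_map F_def)
  finally show ?thesis .
qed

section \<open>The spectrum of the extended graph\<close>

lemma extended_vertices_eq: "extended_vertices k = layer {1..2 * k - 1} (k - 1) \<times> {0, 1}"
  by (auto simp: extended_vertices_def layer_def)

text \<open>
  For \<open>k \<ge> 2\<close> a vertex label is nonempty, so that \<open>v \<inter> w = {}\<close> and \<open>v = w\<close> exclude each other and the graph
  is the bipartite double of \<open>B = O + I\<close>, with \<open>O\<close> the adjacency matrix of the Odd graph. The eigenvalues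
  of \<open>B\<close> are \<open>\<mu> i = (-1)\<^sup>i (k - i) + 1\<close>, and \<open>(-1)\<^sup>i\<close> times \<open>\<mu> i\<close> is \<open>theta_plus k i\<close>, so the pair
  \<open>\<mu> i\<close>, \<open>- \<mu> i\<close> is the pair \<open>theta_plus k i\<close>, \<open>theta_minus k i\<close>, possibly swapped.
\<close>

lemma char_poly_extended_graph:
  assumes k: "k \<ge> 2" and vs: "vertex_listing (extended_graph k) vs"
  shows "char_poly (adjacency_matrix (extended_graph k) vs) =
    (\<Prod>i\<le>k - 1. ([:- of_int (theta_plus k i), 1:] * [:- of_int (theta_minus k i), 1:])
      ^ harmonic_dim (2 * k - 1) i)"
proof -
  define m where "m = k - 1"
  define \<Omega> where "\<Omega> = {1..2 * k - 1}"
  have km: "k = Suc m" "m \<ge> 1" and n: "2 * k - 1 = 2 * m + 1" using k by (auto simp: m_def)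
  have \<Omega>: "finite \<Omega>" "card \<Omega> = 2 * m + 1" using n by (simp_all add: \<Omega>_def)
  obtain xs where xs: "distinct xs" "set xs = layer \<Omega> m"
    using finite_distinct_list[OF finite_layer[OF \<Omega>(1)]] by metis
  define B where "B = (\<lambda>s v w :: nat set. (if v \<inter> w = {} then s else 0) + (if v = w then s else 0) :: complex)"
  have minus_B: "- B 1 v w = B (-1) v w" for v w by (simp add: B_def)
  define \<mu> where "\<mu> = (\<lambda>i. (-1) ^ i * of_nat (Suc m - i) + 1 :: complex)"
  have dist: "distinct vs" and set: "set vs = set xs \<times> {0, 1}"
    using vs by (auto simp: vertex_listing_def extended_graph_def extended_vertices_eq xs \<Omega>_def m_def)
  have "adjacency_matrix (extended_graph k) vs =
      index_mat vs vs (\<lambda>x y. if (x, y) \<in> parcs (extended_graph k) then 1 else 0)"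
    by (simp add: adjacency_matrix_def index_mat_def)
  also have "\<dots> = index_mat vs vs (\<lambda>(v, i) (w, j). if i \<noteq> j then B 1 v w else 0)"
  proof (rule index_mat_cong)
    fix x y assume xy: "x \<in> set vs" "y \<in> set vs"
    obtain v i w j where [simp]: "x = (v, i)" "y = (w, j)" by fastforce
    have "x \<in> extended_vertices k" "y \<in> extended_vertices k"
      using xy vs by (auto simp: vertex_listing_def extended_graph_def)
    moreover have "v \<noteq> {}" using xy km by (auto simp: set xs layer_def)
    ultimately show "(if (x, y) \<in> parcs (extended_graph k) then 1 else 0) =
        (case x of (v, i) \<Rightarrow> \<lambda>(w, j). if i \<noteq> j then B 1 v w else 0) y"
      by (auto simp: extended_graph_def B_def)
  qed
  finally have "char_poly (adjacency_matrix (extended_graph k) vs) =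
      char_poly (index_mat xs xs (B 1)) * char_poly (index_mat xs xs (B (-1)))"
    by (simp only: char_poly_bipartite_double[OF xs(1) dist set] minus_B)
  also have "\<dots> = (\<Prod>i\<le>m. [:- \<mu> i, 1:] ^ harmonic_dim (2 * m + 1) i) *
      (\<Prod>i\<le>m. [:- (- \<mu> i), 1:] ^ harmonic_dim (2 * m + 1) i)"
    unfolding B_def char_poly_disjointness[OF \<Omega> xs] by (simp add: \<mu>_def)
  also have "\<dots> = (\<Prod>i\<le>m. ([:- \<mu> i, 1:] * [:- (- \<mu> i), 1:]) ^ harmonic_dim (2 * m + 1) i)"
    by (simp only: power_mult_distrib prod.distrib)
  also have "\<dots> = (\<Prod>i\<le>m. ([:- of_int (theta_plus k i), 1:] * [:- of_int (theta_minus k i), 1:])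
      ^ harmonic_dim (2 * m + 1) i)"
  proof (rule prod.cong)
    fix i assume "i \<in> {..m}"
    then have "of_int (theta_plus k i) = (-1) ^ i * \<mu> i" "of_int (theta_minus k i) = - ((-1) ^ i * \<mu> i)"
      by (cases "even i"; simp add: theta_plus_def theta_minus_def \<mu>_def km of_nat_diff)+
    then show "([:- \<mu> i, 1:] * [:- (- \<mu> i), 1:]) ^ harmonic_dim (2 * m + 1) i =
      ([:- of_int (theta_plus k i), 1:] * [:- of_int (theta_minus k i), 1:]) ^ harmonic_dim (2 * m + 1) i"
      by (cases "even i") (simp_all add: mult.commute)
  qed simp
  finally show ?thesis by (simp only: m_def[symmetric] n)
qed

lemma order_linear_factor_power:
  "Polynomial.order x ([:- a, 1:] ^ n) = (if a = x then n else 0)"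
  for a x :: "'a :: idom"
  by (auto simp: order_power_n_n intro!: order_0I)

lemma order_prod_linear_factor_powers:
  fixes a b :: "'i \<Rightarrow> 'a :: idom"
  assumes "finite I"
  shows "Polynomial.order x (\<Prod>i\<in>I. ([:- a i, 1:] * [:- b i, 1:]) ^ h i) =
    (\<Sum>i\<in>I. (if a i = x then h i else 0) + (if b i = x then h i else 0))"
  using assms
proof (induction I)
  case (insert i I)
  have nz: "(\<Prod>i\<in>J. ([:- a i, 1:] * [:- b i, 1:]) ^ h i) \<noteq> 0" if "finite J" for J
    using that by (simp del: mult_pCons_left mult_pCons_right)
  from insert nz[of "insert i I"] show ?case
    by (simp add: order_mult power_mult_distrib order_linear_factor_power del: mult_pCons_left mult_pCons_right)
qed simp

lemma theta_minus_eq: "theta_minus k i = - theta_plus k i"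
  by (simp add: theta_minus_def theta_plus_def)

lemma theta_plus_nonneg: "i < k \<Longrightarrow> theta_plus k i \<ge> 0"
  by (cases "even i") (auto simp: theta_plus_def)

lemma theta_plus_eq_0_iff:
  assumes "i < k"
  shows "theta_plus k i = 0 \<longleftrightarrow> even k \<and> i = k - 1"
  using assms by (cases "even i") (auto simp: theta_plus_def, presburger)

text \<open>
  For even \<open>i\<close> the value \<open>k - i + 1\<close> has the parity of \<open>k + 1\<close>, for odd \<open>i\<close> the value \<open>k - i - 1\<close> has the
  parity of \<open>k\<close>, and both are strictly decreasing in \<open>i\<close>.
\<close>

lemma theta_plus_inj:
  assumes "theta_plus k i = theta_plus k j"
  shows "i = j"
  using assms by (cases "even i"; cases "even j") (auto simp: theta_plus_def, presburger+)

lemma int_harmonic_dim: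
  assumes "2 * i \<le> n"
  shows "int (harmonic_dim n i) = binom n (int i) - binom n (int i - 1)"
proof (cases i)
  case (Suc m)
  with assms have "n choose m \<le> n choose i" by (intro binomial_mono) auto
  moreover have "binom n (int i - 1) = int (n choose m)" using Suc by (simp add: binom_def)
  moreover have "binom n (int i) = int (n choose i)" by (simp add: binom_def)
  ultimately show ?thesis using Suc by (simp add: harmonic_dim_def of_nat_diff)
qed (simp add: harmonic_dim_def binom_def)

lemma harmonic_dim_pos: "2 * i \<le> n \<Longrightarrow> harmonic_dim n i > 0"
  using binomial_strict_mono[of "i - 1" i n] by (auto simp: harmonic_dim_def split: nat.split)

lemma eigenvalue_iff_multiplicity_pos:
  assumes "A \<in> carrier_mat n n"
  shows "eigenvalue A x \<longleftrightarrow> eigenvalue_multiplicity A x > 0"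
proof -
  have "char_poly A \<noteq> 0" using degree_monic_char_poly[OF assms] by auto
  then show ?thesis
    by (simp add: eigenvalue_root_char_poly[OF assms] eigenvalue_multiplicity_def order_root)
qed

lemma eigenvalue_multiplicity_extended_graph:
  assumes "k \<ge> 2" and "vertex_listing (extended_graph k) vs"
  shows "eigenvalue_multiplicity (adjacency_matrix (extended_graph k) vs) x =
    (\<Sum>i<k. (if of_int (theta_plus k i) = x then harmonic_dim (2 * k - 1) i else 0) +
      (if of_int (theta_minus k i) = x then harmonic_dim (2 * k - 1) i else 0))"
proof -
  have "{..<k} = {..k - 1}" using assms(1) by auto
  then show ?thesis
    unfolding eigenvalue_multiplicity_def char_poly_extended_graph[OF assms]
    by (simp only: order_prod_linear_factor_powers finite_atMost)
qed

lemma eigenvalue_extended_graph_iff: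
  assumes "k \<ge> 2" and "vertex_listing (extended_graph k) vs"
  shows "eigenvalue (adjacency_matrix (extended_graph k) vs) x \<longleftrightarrow>
    (\<exists>i<k. x = of_int (theta_plus k i) \<or> x = of_int (theta_minus k i))"
proof -
  have "adjacency_matrix (extended_graph k) vs \<in> carrier_mat (length vs) (length vs)"
    by (simp add: adjacency_matrix_def)
  moreover have "harmonic_dim (2 * k - 1) i \<noteq> 0" if "i < k" for i
    using that harmonic_dim_pos[of i "2 * k - 1"] by simp
  ultimately show ?thesis
    by (auto simp: eigenvalue_iff_multiplicity_pos eigenvalue_multiplicity_extended_graph[OF assms] simp flip: neq0_conv)
qed

text \<open>
  The absolute values of the eigenvalues are distinct for distinct indices, so only the factors of
  index \<open>i\<close> contribute: both of them if \<open>\<theta> = 0\<close>, and just one otherwise.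
\<close>

lemma eigenvalue_multiplicity_theta:
  assumes k: "k \<ge> 2" and vs: "vertex_listing (extended_graph k) vs" and i: "i < k"
    and \<theta>: "\<theta> \<in> {theta_plus k i, theta_minus k i}"
  shows "eigenvalue_multiplicity (adjacency_matrix (extended_graph k) vs) (of_int \<theta>) =
    (if \<theta> = 0 then 2 else 1) * harmonic_dim (2 * k - 1) i"
proof -
  have eq: "\<bar>theta_plus k j\<bar> = \<bar>theta_plus k i\<bar> \<longleftrightarrow> j = i" if "j < k" for j
    using that i theta_plus_nonneg theta_plus_inj by (metis abs_of_nonneg)
  have "eigenvalue_multiplicity (adjacency_matrix (extended_graph k) vs) (of_int \<theta>) =
      (\<Sum>j<k. if j = i then (if \<theta> = 0 then 2 else 1) * harmonic_dim (2 * k - 1) i else 0)"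
    unfolding eigenvalue_multiplicity_extended_graph[OF k vs] of_int_eq_iff
  proof (rule sum.cong)
    fix j assume "j \<in> {..<k}"
    then show "(if theta_plus k j = \<theta> then harmonic_dim (2 * k - 1) j else 0) +
        (if theta_minus k j = \<theta> then harmonic_dim (2 * k - 1) j else 0) =
        (if j = i then (if \<theta> = 0 then 2 else 1) * harmonic_dim (2 * k - 1) i else 0)"
      using eq[of j] \<theta> by (auto simp: theta_minus_eq)
  qed simp
  with i show ?thesis by simp
qed

theorem theorem3p9:
  fixes k :: nat and vs :: "(nat set \<times> nat) list"
  assumes "k \<ge> 3"
    and "vertex_listing (extended_graph k) vs"
  defines "A \<equiv> adjacency_matrix (extended_graph k) vs"
  shows "integral_graph (extended_graph k) \<and>
    (odd k \<longrightarrow>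
       {\<theta>. eigenvalue A \<theta>} =
         {of_int (theta_plus k i) | i. i \<le> k - 1} \<union> {of_int (theta_minus k i) | i. i \<le> k - 1} \<and>
       (\<forall>i \<le> k - 1.
          int (eigenvalue_multiplicity A (of_int (theta_plus k i))) =
            binom (2 * k - 1) (int i) - binom (2 * k - 1) (int i - 1) \<and>
          int (eigenvalue_multiplicity A (of_int (theta_minus k i))) =
            binom (2 * k - 1) (int i) - binom (2 * k - 1) (int i - 1))) \<and>
    (even k \<longrightarrow>
       theta_plus k (k - 1) = 0 \<and> theta_minus k (k - 1) = 0 \<and>
       {\<theta>. eigenvalue A \<theta>} =
         {of_int (theta_plus k i) | i. i \<le> k - 2} \<union> {of_int (theta_minus k i) | i. i \<le> k - 2} \<union>
         {0} \<and>
       (\<forall>i \<le> k - 2.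
          int (eigenvalue_multiplicity A (of_int (theta_plus k i))) =
            binom (2 * k - 1) (int i) - binom (2 * k - 1) (int i - 1) \<and>
          int (eigenvalue_multiplicity A (of_int (theta_minus k i))) =
            binom (2 * k - 1) (int i) - binom (2 * k - 1) (int i - 1)) \<and>
       int (eigenvalue_multiplicity A 0) =
         2 * (binom (2 * k - 1) (int (k - 1)) - binom (2 * k - 1) (int (k - 2))))"
proof -
  have k: "k \<ge> 2" using assms(1) by simp
  have eig: "eigenvalue A x \<longleftrightarrow> (\<exists>i<k. x = of_int (theta_plus k i) \<or> x = of_int (theta_minus k i))" for x
    unfolding A_def by (rule eigenvalue_extended_graph_iff[OF k assms(2)])
  have mult: "int (eigenvalue_multiplicity A (of_int \<theta>)) =
      (if \<theta> = 0 then 2 else 1) * (binom (2 * k - 1) (int i) - binom (2 * k - 1) (int i - 1))"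
    if "i < k" "\<theta> \<in> {theta_plus k i, theta_minus k i}" for i \<theta>
    using eigenvalue_multiplicity_theta[OF k assms(2) that] int_harmonic_dim[of i "2 * k - 1"] that(1)
    by (simp add: A_def)
  have zero: "theta_plus k i = 0 \<longleftrightarrow> even k \<and> i = k - 1" "theta_minus k i = 0 \<longleftrightarrow> even k \<and> i = k - 1"
    if "i < k" for i
    using theta_plus_eq_0_iff[OF that] by (simp_all add: theta_minus_eq)
  have simple: "int (eigenvalue_multiplicity A (of_int (theta_plus k i))) =
        binom (2 * k - 1) (int i) - binom (2 * k - 1) (int i - 1) \<and>
      int (eigenvalue_multiplicity A (of_int (theta_minus k i))) =
        binom (2 * k - 1) (int i) - binom (2 * k - 1) (int i - 1)"
    if "i < k" "odd k \<or> i \<noteq> k - 1" for i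
  proof -
    have "theta_plus k i \<noteq> 0" "theta_minus k i \<noteq> 0" using zero[OF that(1)] that(2) by auto
    then show ?thesis using mult[OF that(1)] by simp
  qed
  have is_integral: "integral_graph (extended_graph k)"
    unfolding integral_graph_def
    using pair_graph_extended_graph eigenvalue_extended_graph_iff[OF k] by auto
  have spectrum_odd: "{\<theta>. eigenvalue A \<theta>} =
      {of_int (theta_plus k i) | i. i \<le> k - 1} \<union> {of_int (theta_minus k i) | i. i \<le> k - 1}"
  proof -
    have "i < k \<longleftrightarrow> i \<le> k - 1" for i using k by auto
    then show ?thesis unfolding eig by auto
  qed
  have spectrum_even: "{\<theta>. eigenvalue A \<theta>} =
      {of_int (theta_plus k i) | i. i \<le> k - 2} \<union> {of_int (theta_minus k i) | i. i \<le> k - 2} \<union> {0}"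
    if "even k"
  proof -
    have "i < k \<longleftrightarrow> i \<le> k - 2 \<or> i = k - 1" for i using k by auto
    then have ex: "(\<exists>i<k. P i) \<longleftrightarrow> (\<exists>i\<le>k - 2. P i) \<or> P (k - 1)" for P by metis
    have "theta_plus k (k - 1) = 0" "theta_minus k (k - 1) = 0"
      using zero[of "k - 1"] that k by simp_all
    then show ?thesis unfolding eig ex by auto
  qed
  have mult_zero: "int (eigenvalue_multiplicity A 0) =
      2 * (binom (2 * k - 1) (int (k - 1)) - binom (2 * k - 1) (int (k - 2)))" if "even k"
  proof -
    have "int (k - 1) - 1 = int (k - 2)" using k by simp
    then show ?thesis using mult[of "k - 1" 0] zero[of "k - 1"] that k by simp
  qed
  show ?thesis
  proof (intro conjI impI allI)
    assume "even k"
    then show "theta_plus k (k - 1) = 0" "theta_minus k (k - 1) = 0"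
      using zero[of "k - 1"] k by simp_all
  qed (use is_integral spectrum_odd spectrum_even mult_zero simple k in simp_all)
qed

end
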